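(* As $\gamma$ ranges over all weak compositions, $\{\mathcal{L}_\gamma\}$ forms a finite basis for the polynomial ring $\mathbb{Z}[\beta][x_1,x_2,\dots]$ over $\mathbb{Z}[\beta]$; that is, every polynomial in $\mathbb{Z}[\beta][x_1,x_2,\dots]$ can be written uniquely as a finite $\mathbb{Z}[\beta]$-linear combination of the $\mathcal{L}_\gamma$.
   Context: $\beta$ is an indeterminate. A weak composition $\gamma=(\gamma_1,\dots,\gamma_n)$ is a finite sequence of nonnegative integers; weak compositions differing only by trailing zeros are identified. $|\gamma|=\sum_i\gamma_i$. Skyline diagrams. The skyline diagram of $\gamma$ has left-justified rows numbered $1,\dots,n$ from top to bottom, with boxes $(i,j)$, $1\le j\le\gamma_i$, in row $i$, plus a basement box $(i,0)$ in each row containing the fixed value $b_i=i$. A set-valued filling assigns a nonempty finite set of positive integers to each non-basement box. The maximum of a box is its anchor entry; the other entries of the box are free entries. A basement box is treated as a box with the single (anchor) entry $i$. Triples, for rows $i<j$ and a column $k\ge0$. Type A (when $\gamma_i\ge\gamma_j$): the boxes $(i,k),(i,k+1),(j,k+1)$, with anchor entries $c,a,b$ respectively. Type B (when $\gamma_i<\gamma_j$): the boxes $(i,k),(j,k),(j,k+1)$, with anchor entries $b,c,a$ respectively. (All three boxes must exist; basement boxes are allowed.) A triple is an inversion triple if $b>c\ge a$ or $c\ge a>b$. A set-valued filling is semistandard if: (S1) entries do not repeat in a column; (S2) rows, including the basement, are weakly decreasing from left to right, where for sets $A\ge B$ means $\min A\ge\max B$; (S3) every triple of anchor entries (including basement boxes)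 is an inversion triple; (S4) every free entry is in the highest (lowest-numbered) row possible within its column: a free entry $x$ in column $j$ lies in the smallest-numbered row $i$ such that the box $(i,j)$ exists, $x$ is smaller than the anchor entry of $(i,j)$ (so $x$ is free there), and placing $x$ there does not violate (S2), i.e. $x$ is at least the anchor entry of $(i,j+1)$ if that box exists. $\mathsf{SetSkyFill}(\gamma)$ is the set of semistandard set-valued fillings of shape $\gamma$ with basement $b_i=i$. For such $F$, $|F|$ is the total number of entries (not counting the basement) and $x^F=\prod_i x_i^{m_i}$, where $m_i$ is the number of occurrences of $i$ in $F$ outside the basement. The combinatorial Lascoux atom is $$\mathcal{L}_\gamma=\sum_{F\in\mathsf{SetSkyFill}(\gamma)}\beta^{|F|-|\gamma|}x^F\in\mathbb{Z}[\beta][x_1,\dots,x_n].$$ *)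

theory Defs
  imports "HOL-Library.Poly_Mapping" "HOL-Computational_Algebra.Polynomial"
begin

text \<open>
  Rows, entries and variables are numbered from 0 rather than from 1: row \<open>i\<close>, entry \<open>i\<close> and variable
  \<open>i\<close> here are the paper's row \<open>i + 1\<close>, entry \<open>i + 1\<close> and variable \<open>x\<^sub>i\<^sub>+\<^sub>1\<close>, so that the entries are all
  of \<^typ>\<open>nat\<close>. The conditions on fillings only compare rows and entries, so they are unaffected by
  this shift. Columns keep their numbers, with column 0 the basement.
\<close>

text \<open>
  A finitely supported function is a weak composition up to trailing zeros. Rows beyond the last
  nonzero part consist of a basement box only; no condition below involves them, since a triple
  always contains a non-basement box of its lower row.
\<close>
type_synonym weak_composition = "nat \<Rightarrow>\<^sub>0 nat"

text \<open>The ring \<open>\<int>[\<beta>][x\<^sub>1, x\<^sub>2, \<dots>]\<close>: maps from exponent vectors to coefficients in \<open>\<int>[\<beta>]\<close>.\<close>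
type_synonym beta_mpoly = "(nat \<Rightarrow>\<^sub>0 nat) \<Rightarrow>\<^sub>0 int poly"

definition Const :: "int poly \<Rightarrow> beta_mpoly" where
  "Const c = Poly_Mapping.single 0 c"

definition Var :: "nat \<Rightarrow> beta_mpoly" where
  "Var i = Poly_Mapping.single (Poly_Mapping.single i 1) 1"

definition beta :: "int poly" where
  "beta = [:0, 1:]"

text \<open>The basement boxes are included.\<close>
definition is_box :: "weak_composition \<Rightarrow> nat \<Rightarrow> nat \<Rightarrow> bool" where
  "is_box \<gamma> i k \<longleftrightarrow> k \<le> Poly_Mapping.lookup \<gamma> i"

definition skyline :: "weak_composition \<Rightarrow> (nat \<times> nat) set" where
  "skyline \<gamma> = {(i, k). is_box \<gamma> i k \<and> 1 \<le> k}"

text \<open>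
  \<open>F i k\<close> is the set of entries of box \<open>(i, k)\<close>; it is fixed to be empty where there is no box, so
  that each filling of the diagram is represented by exactly one function.
\<close>
definition set_valued_filling :: "weak_composition \<Rightarrow> (nat \<Rightarrow> nat \<Rightarrow> nat set) \<Rightarrow> bool" where
  "set_valued_filling \<gamma> F \<longleftrightarrow>
     (\<forall>i. F i 0 = {i}) \<and>
     (\<forall>(i, k) \<in> skyline \<gamma>. finite (F i k) \<and> F i k \<noteq> {}) \<and>
     (\<forall>i k. \<not> is_box \<gamma> i k \<longrightarrow> F i k = {})"

definition anchor :: "(nat \<Rightarrow> nat \<Rightarrow> nat set) \<Rightarrow> nat \<Rightarrow> nat \<Rightarrow> nat" where
  "anchor F i k = Max (F i k)"

definition inversion_triple :: "nat \<Rightarrow> nat \<Rightarrow> nat \<Rightarrow> bool" where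
  "inversion_triple a b c \<longleftrightarrow> (b > c \<and> c \<ge> a) \<or> (c \<ge> a \<and> a > b)"

definition column_distinct :: "(nat \<Rightarrow> nat \<Rightarrow> nat set) \<Rightarrow> bool" where
  "column_distinct F \<longleftrightarrow> (\<forall>k i j. i \<noteq> j \<longrightarrow> F i k \<inter> F j k = {})"

definition rows_decreasing :: "weak_composition \<Rightarrow> (nat \<Rightarrow> nat \<Rightarrow> nat set) \<Rightarrow> bool" where
  "rows_decreasing \<gamma> F \<longleftrightarrow>
     (\<forall>i k. is_box \<gamma> i (Suc k) \<longrightarrow> Min (F i k) \<ge> Max (F i (Suc k)))"

definition triples_inverted :: "weak_composition \<Rightarrow> (nat \<Rightarrow> nat \<Rightarrow> nat set) \<Rightarrow> bool" where
  "triples_inverted \<gamma> F \<longleftrightarrow>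
     (\<forall>i j k. i < j \<and> Poly_Mapping.lookup \<gamma> i \<ge> Poly_Mapping.lookup \<gamma> j \<and>
        is_box \<gamma> i k \<and> is_box \<gamma> i (Suc k) \<and> is_box \<gamma> j (Suc k) \<longrightarrow>
        inversion_triple (anchor F i (Suc k)) (anchor F j (Suc k)) (anchor F i k)) \<and>
     (\<forall>i j k. i < j \<and> Poly_Mapping.lookup \<gamma> i < Poly_Mapping.lookup \<gamma> j \<and>
        is_box \<gamma> i k \<and> is_box \<gamma> j k \<and> is_box \<gamma> j (Suc k) \<longrightarrow>
        inversion_triple (anchor F j (Suc k)) (anchor F i k) (anchor F j k))"

text \<open>Whether \<open>x\<close> could be a free entry of box \<open>(i, k)\<close>, given the anchor entries of row \<open>i\<close>.\<close>
definition free_position ::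
  "weak_composition \<Rightarrow> (nat \<Rightarrow> nat \<Rightarrow> nat set) \<Rightarrow> nat \<Rightarrow> nat \<Rightarrow> nat \<Rightarrow> bool" where
  "free_position \<gamma> F x k i \<longleftrightarrow>
     is_box \<gamma> i k \<and> x < anchor F i k \<and> (is_box \<gamma> i (Suc k) \<longrightarrow> anchor F i (Suc k) \<le> x)"

definition free_entries_highest :: "weak_composition \<Rightarrow> (nat \<Rightarrow> nat \<Rightarrow> nat set) \<Rightarrow> bool" where
  "free_entries_highest \<gamma> F \<longleftrightarrow>
     (\<forall>(i, k) \<in> skyline \<gamma>. \<forall>x \<in> F i k. x \<noteq> anchor F i k \<longrightarrow>
        free_position \<gamma> F x k i \<and> (\<forall>i' < i. \<not> free_position \<gamma> F x k i'))"

definition SetSkyFill :: "weak_composition \<Rightarrow> (nat \<Rightarrow> nat \<Rightarrow> nat set) set" where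
  "SetSkyFill \<gamma> = {F. set_valued_filling \<gamma> F \<and> column_distinct F \<and> rows_decreasing \<gamma> F \<and>
     triples_inverted \<gamma> F \<and> free_entries_highest \<gamma> F}"

definition comp_size :: "weak_composition \<Rightarrow> nat" where
  "comp_size \<gamma> = (\<Sum>i \<in> Poly_Mapping.keys \<gamma>. Poly_Mapping.lookup \<gamma> i)"

definition num_entries :: "weak_composition \<Rightarrow> (nat \<Rightarrow> nat \<Rightarrow> nat set) \<Rightarrow> nat" where
  "num_entries \<gamma> F = (\<Sum>(i, k) \<in> skyline \<gamma>. card (F i k))"

definition multiplicity_in :: "weak_composition \<Rightarrow> (nat \<Rightarrow> nat \<Rightarrow> nat set) \<Rightarrow> nat \<Rightarrow> nat" where
  "multiplicity_in \<gamma> F x = card {(i, k) \<in> skyline \<gamma>. x \<in> F i k}"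

definition filling_monomial :: "weak_composition \<Rightarrow> (nat \<Rightarrow> nat \<Rightarrow> nat set) \<Rightarrow> beta_mpoly" where
  "filling_monomial \<gamma> F =
     (\<Prod>x \<in> (\<Union>(i, k) \<in> skyline \<gamma>. F i k). Var x ^ multiplicity_in \<gamma> F x)"

text \<open>
  The exponent of \<open>\<beta>\<close> is a natural number because boxes are nonempty. The sum is over a finite set,
  see \<open>finite_SetSkyFill\<close> below.
\<close>
definition lascoux_atom :: "weak_composition \<Rightarrow> beta_mpoly" where
  "lascoux_atom \<gamma> = (\<Sum>F \<in> SetSkyFill \<gamma>.
     Const (beta ^ (num_entries \<gamma> F - comp_size \<gamma>)) * filling_monomial \<gamma> F)"

lemma finite_skyline: "finite (skyline \<gamma>)"
proof -
  have "skyline \<gamma> \<subseteq> (SIGMA i : Poly_Mapping.keys \<gamma>. {..Poly_Mapping.lookup \<gamma> i})"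
    by (auto simp: skyline_def is_box_def in_keys_iff)
  then show ?thesis
    by (rule finite_subset) auto
qed

lemma SetSkyFill_entry_le:
  assumes "F \<in> SetSkyFill \<gamma>" "x \<in> F i k"
  shows "x \<le> i"
  using assms(2)
proof (induction k arbitrary: x)
  case 0
  then show ?case using assms(1) by (auto simp: SetSkyFill_def set_valued_filling_def)
next
  case (Suc k)
  have fill: "set_valued_filling \<gamma> F" and dec: "rows_decreasing \<gamma> F"
    using assms(1) by (auto simp: SetSkyFill_def)
  have box: "is_box \<gamma> i (Suc k)"
    using fill Suc.prems unfolding set_valued_filling_def by blast
  have sky: "(i, Suc k) \<in> skyline \<gamma>"
    using box by (auto simp: skyline_def)
  have fin: "finite (F i (Suc k))"
    using fill sky unfolding set_valued_filling_def by fastforce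
  have prev: "finite (F i k) \<and> F i k \<noteq> {}"
  proof (cases k)
    case 0
    then show ?thesis using fill by (auto simp: set_valued_filling_def)
  next
    case (Suc m)
    then have "(i, k) \<in> skyline \<gamma>" using box by (auto simp: skyline_def is_box_def)
    then show ?thesis using fill unfolding set_valued_filling_def by fastforce
  qed
  have "x \<le> Max (F i (Suc k))" using fin Suc.prems by simp
  also have "\<dots> \<le> Min (F i k)" using dec box by (auto simp: rows_decreasing_def)
  also have "\<dots> \<le> i" using Suc.IH[of "Min (F i k)"] prev by simp
  finally show ?case .
qed

lemma finite_SetSkyFill: "finite (SetSkyFill \<gamma>)"
proof -
  define extend :: "((nat \<times> nat) \<Rightarrow> nat set) \<Rightarrow> nat \<Rightarrow> nat \<Rightarrow> nat set" where
    "extend G = (\<lambda>i k. if k = 0 then {i} else G (i, k))" for G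
  define N where "N = Max (insert 0 (fst ` skyline \<gamma>))"
  define A where "A = {G. \<forall>b. (b \<in> skyline \<gamma> \<longrightarrow> G b \<in> Pow {..N}) \<and> (b \<notin> skyline \<gamma> \<longrightarrow> G b = {})}"
  have "finite A"
    unfolding A_def by (rule finite_set_of_finite_funs) (auto simp: finite_skyline)
  moreover have "SetSkyFill \<gamma> \<subseteq> extend ` A"
  proof
    fix F assume F: "F \<in> SetSkyFill \<gamma>"
    then have fill: "set_valued_filling \<gamma> F" by (simp add: SetSkyFill_def)
    define G where "G = (\<lambda>(i, k). if (i, k) \<in> skyline \<gamma> then F i k else {})"
    have le: "x \<le> N" if "(i, k) \<in> skyline \<gamma>" "x \<in> F i k" for i k x
    proof -
      have "i \<le> N"
        unfolding N_def using that(1) by (intro Max_ge) (auto simp: finite_skyline intro: rev_image_eqI)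
      then show ?thesis using SetSkyFill_entry_le[OF F that(2)] by simp
    qed
    have "G \<in> A"
      using le by (auto simp: A_def G_def)
    moreover have "F = extend G"
      using fill by (intro ext) (auto simp: extend_def G_def set_valued_filling_def skyline_def)
    ultimately show "F \<in> extend ` A" by blast
  qed
  ultimately show ?thesis
    using finite_surj by blast
qed

end

theory Submission
  imports Defs
begin

text \<open>
  Fix \<open>n\<close> larger than all row indices and give the variable \<open>x\<^sub>i\<close> the positive weight \<open>n - i\<close>. Entries
  of row \<open>i\<close> are at most \<open>i\<close>, so the monomial of a filling of shape \<open>\<gamma>\<close> has weight at least that of
  \<open>x\<^sup>\<gamma>\<close>, with equality only for the filling whose rows are constant. Hence \<open>\<L>\<^sub>\<gamma>\<close> is \<open>x\<^sup>\<gamma>\<close> plus terms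
  of larger weight. Since entries do not repeat in a column, all exponents in \<open>\<L>\<^sub>\<gamma>\<close> are at most the
  largest part of \<open>\<gamma>\<close>, which makes the unitriangular system finite and thus invertible.
\<close>

section \<open>Weights of exponent vectors\<close>

definition weight :: "nat \<Rightarrow> (nat \<Rightarrow>\<^sub>0 nat) \<Rightarrow> nat" where
  "weight n \<delta> = (\<Sum>i \<in> Poly_Mapping.keys \<delta>. Poly_Mapping.lookup \<delta> i * (n - i))"

lemma weight_eq_sum:
  assumes "finite A" "Poly_Mapping.keys \<delta> \<subseteq> A"
  shows "weight n \<delta> = (\<Sum>i \<in> A. Poly_Mapping.lookup \<delta> i * (n - i))"
  unfolding weight_def
  by (rule sum.mono_neutral_left) (use assms in \<open>auto simp: in_keys_iff\<close>)

lemma skyline_Sigma: "skyline \<gamma> = (SIGMA i : Poly_Mapping.keys \<gamma>. {1..Poly_Mapping.lookup \<gamma> i})"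
  by (auto simp: skyline_def is_box_def in_keys_iff)

lemma comp_size_eq_card: "comp_size \<gamma> = card (skyline \<gamma>)"
  by (simp add: skyline_Sigma comp_size_def)

lemma weight_eq_sum_skyline: "weight n \<gamma> = (\<Sum>(i, k) \<in> skyline \<gamma>. n - i)"
  by (simp add: skyline_Sigma weight_def sum.Sigma[symmetric])

section \<open>Exponent vectors of fillings\<close>

text \<open>The exponent vector of x^F, summed over the index set of the product in
  \<open>filling_monomial\<close>, so that the product turns into it factor by factor.\<close>

definition content :: "weak_composition \<Rightarrow> (nat \<Rightarrow> nat \<Rightarrow> nat set) \<Rightarrow> nat \<Rightarrow>\<^sub>0 nat" where
  "content \<gamma> F =
     (\<Sum>x \<in> (\<Union>(i, k) \<in> skyline \<gamma>. F i k). Poly_Mapping.single x (multiplicity_in \<gamma> F x))"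

lemma Var_power: "Var x ^ m = Poly_Mapping.single (Poly_Mapping.single x m) 1"
  by (induction m) (simp_all add: Var_def mult_single single_add[symmetric])

lemma prod_single_one:
  "(\<Prod>x \<in> A. Poly_Mapping.single (f x) 1) =
     (Poly_Mapping.single (\<Sum>x \<in> A. f x) 1 :: ('a::comm_monoid_add \<Rightarrow>\<^sub>0 'b::comm_semiring_1))"
  by (induction A rule: infinite_finite_induct) (simp_all add: mult_single)

lemma filling_monomial_eq_single: "filling_monomial \<gamma> F = Poly_Mapping.single (content \<gamma> F) 1"
  by (simp add: filling_monomial_def content_def Var_power prod_single_one)

lemma finite_box:
  assumes "F \<in> SetSkyFill \<gamma>"
  shows "finite (F i k)"
  using SetSkyFill_entry_le[OF assms] finite_nat_set_iff_bounded_le by blast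

lemma finite_entries:
  assumes "F \<in> SetSkyFill \<gamma>"
  shows "finite (\<Union>(i, k) \<in> skyline \<gamma>. F i k)"
  using finite_box[OF assms] by (auto simp: finite_skyline)

lemma lookup_content:
  assumes "F \<in> SetSkyFill \<gamma>"
  shows "Poly_Mapping.lookup (content \<gamma> F) x = multiplicity_in \<gamma> F x"
proof -
  let ?U = "\<Union>(i, k) \<in> skyline \<gamma>. F i k"
  have "Poly_Mapping.lookup (content \<gamma> F) x = (\<Sum>y \<in> ?U. if x = y then multiplicity_in \<gamma> F y else 0)"
    by (auto simp: content_def lookup_sum lookup_single when_def intro!: sum.cong)
  also have "\<dots> = (if x \<in> ?U then multiplicity_in \<gamma> F x else 0)"
    using finite_entries[OF assms] by (simp only: sum.delta')
  also have "\<dots> = multiplicity_in \<gamma> F x"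
  proof (cases "x \<in> ?U")
    case False
    then have "{(i, k) \<in> skyline \<gamma>. x \<in> F i k} = {}" by auto
    then have "multiplicity_in \<gamma> F x = 0" unfolding multiplicity_in_def by (metis card.empty)
    then show ?thesis by simp
  qed (simp only: if_True)
  finally show ?thesis .
qed

text \<open>Double counting of pairs of a box and an entry in it: grouping by entry gives the
  weight, grouping by box gives a sum that can be compared term by term with
  \<open>weight_eq_sum_skyline\<close>.\<close>

lemma weight_content:
  assumes "F \<in> SetSkyFill \<gamma>"
  shows "weight n (content \<gamma> F) = (\<Sum>(i, k) \<in> skyline \<gamma>. \<Sum>x \<in> F i k. n - x)"
proof -
  define U where "U = (\<Union>(i, k) \<in> skyline \<gamma>. F i k)"
  have fin: "finite U" unfolding U_def by (rule finite_entries[OF assms])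
  have "Poly_Mapping.keys (content \<gamma> F) \<subseteq> U"
  proof
    fix x assume "x \<in> Poly_Mapping.keys (content \<gamma> F)"
    then have "multiplicity_in \<gamma> F x \<noteq> 0" by (simp add: in_keys_iff lookup_content[OF assms])
    then have "{(i, k) \<in> skyline \<gamma>. x \<in> F i k} \<noteq> {}"
      unfolding multiplicity_in_def by (metis card.empty)
    then show "x \<in> U" by (auto simp: U_def)
  qed
  then have "weight n (content \<gamma> F) = (\<Sum>x \<in> U. multiplicity_in \<gamma> F x * (n - x))"
    by (simp add: weight_eq_sum[OF fin] lookup_content[OF assms])
  also have "\<dots> = (\<Sum>x \<in> U. \<Sum>b \<in> skyline \<gamma>. if x \<in> F (fst b) (snd b) then n - x else 0)"
    by (intro sum.cong refl)
      (simp add: sum.If_cases[OF finite_skyline] multiplicity_in_def case_prod_unfold Int_def)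
  also have "\<dots> = (\<Sum>b \<in> skyline \<gamma>. \<Sum>x \<in> U. if x \<in> F (fst b) (snd b) then n - x else 0)"
    by (rule sum.swap)
  also have "\<dots> = (\<Sum>b \<in> skyline \<gamma>. \<Sum>x \<in> F (fst b) (snd b). n - x)"
  proof (rule sum.cong[OF refl])
    fix b assume "b \<in> skyline \<gamma>"
    then have "U \<inter> {x. x \<in> F (fst b) (snd b)} = F (fst b) (snd b)"
      by (force simp: U_def)
    then show "(\<Sum>x \<in> U. if x \<in> F (fst b) (snd b) then n - x else 0) =
        (\<Sum>x \<in> F (fst b) (snd b). n - x)"
      by (simp add: sum.If_cases[OF fin])
  qed
  finally show ?thesis by (simp add: case_prod_unfold)
qed

section \<open>The filling of least weight\<close>

definition constant_filling :: "weak_composition \<Rightarrow> nat \<Rightarrow> nat \<Rightarrow> nat set" where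
  "constant_filling \<gamma> i k = (if is_box \<gamma> i k then {i} else {})"

text \<open>With constant rows a type A triple has a = c = i and b = j, so b > c \<ge> a; a type B
  triple has b = i and a = c = j, so c \<ge> a > b. Singletons contain no free entries.\<close>

lemma constant_filling_in_SetSkyFill: "constant_filling \<gamma> \<in> SetSkyFill \<gamma>"
  by (auto simp: SetSkyFill_def set_valued_filling_def column_distinct_def rows_decreasing_def
      triples_inverted_def free_entries_highest_def constant_filling_def anchor_def
      inversion_triple_def is_box_def skyline_def)

lemma content_constant_filling: "content \<gamma> (constant_filling \<gamma>) = \<gamma>"
proof (rule poly_mapping_eqI)
  fix x
  have "{(i, k) \<in> skyline \<gamma>. x \<in> constant_filling \<gamma> i k} =
      Pair x ` {1..Poly_Mapping.lookup \<gamma> x}"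
    by (auto simp: constant_filling_def skyline_def is_box_def)
  then have "multiplicity_in \<gamma> (constant_filling \<gamma>) x = card (Pair x ` {1..Poly_Mapping.lookup \<gamma> x})"
    unfolding multiplicity_in_def by metis
  also have "\<dots> = Poly_Mapping.lookup \<gamma> x"
    by (subst card_image) (auto simp: inj_on_def)
  finally show "Poly_Mapping.lookup (content \<gamma> (constant_filling \<gamma>)) x = Poly_Mapping.lookup \<gamma> x"
    by (simp add: lookup_content[OF constant_filling_in_SetSkyFill])
qed

lemma num_entries_constant_filling: "num_entries \<gamma> (constant_filling \<gamma>) = comp_size \<gamma>"
proof -
  have "num_entries \<gamma> (constant_filling \<gamma>) = (\<Sum>b \<in> skyline \<gamma>. 1)"
    unfolding num_entries_def by (intro sum.cong) (auto simp: skyline_def constant_filling_def)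
  then show ?thesis by (simp add: comp_size_eq_card)
qed

text \<open>Boxes are compared one by one: a box of row i is nonempty with entries at most i, so it
  contributes at least \<open>n - i\<close>; a box other than {i} has an entry below i and
  contributes strictly more.\<close>

lemma weight_less_weight_content:
  assumes F: "F \<in> SetSkyFill \<gamma>" "F \<noteq> constant_filling \<gamma>"
    and n: "\<And>i. i \<in> Poly_Mapping.keys \<gamma> \<Longrightarrow> i < n"
  shows "weight n \<gamma> < weight n (content \<gamma> F)"
proof -
  have fill: "set_valued_filling \<gamma> F" using F(1) by (simp add: SetSkyFill_def)
  have bound: "i < n" if "(i, k) \<in> skyline \<gamma>" for i k
    using that n by (auto simp: skyline_Sigma)
  have split: "(\<Sum>x \<in> F i k. n - x) = (n - x) + (\<Sum>y \<in> F i k - {x}. n - y)" if "x \<in> F i k" for i k x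
    using that finite_box[OF F(1)] by (rule sum.remove[rotated])
  have le: "n - i \<le> (\<Sum>x \<in> F i k. n - x)" if "(i, k) \<in> skyline \<gamma>" for i k
  proof -
    obtain x where "x \<in> F i k" using fill \<open>(i, k) \<in> skyline \<gamma>\<close> unfolding set_valued_filling_def by blast
    then show ?thesis using split[of x i k] SetSkyFill_entry_le[OF F(1), of x i k] by simp
  qed
  obtain i k where ik: "F i k \<noteq> constant_filling \<gamma> i k" using F(2) by blast
  \<comment> \<open>Both fillings agree in the basement and outside the diagram, so they differ in a
    genuine box.\<close>
  have sky: "(i, k) \<in> skyline \<gamma>"
    using ik fill by (cases k) (auto simp: set_valued_filling_def constant_filling_def skyline_def is_box_def)
  then have "F i k \<noteq> {i}" using ik by (auto simp: constant_filling_def skyline_def)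
  moreover have "F i k \<noteq> {}" using fill sky unfolding set_valued_filling_def by blast
  ultimately obtain x where x: "x \<in> F i k" "x \<noteq> i" by blast
  then have "x < i" using SetSkyFill_entry_le[OF F(1), of x i k] by simp
  \<comment> \<open>Subtraction is truncated; x < i gives \<open>n - i < n - x\<close> because i <
    n.\<close>
  then have "n - i < (\<Sum>x \<in> F i k. n - x)" using split[OF x(1)] bound[OF sky] by simp
  then have "(\<Sum>b \<in> skyline \<gamma>. n - fst b) < (\<Sum>b \<in> skyline \<gamma>. \<Sum>x \<in> F (fst b) (snd b). n - x)"
    using le sky by (intro sum_strict_mono_ex1) (auto simp: finite_skyline intro!: bexI[of _ "(i, k)"])
  then show ?thesis
    by (simp add: weight_content[OF F(1)] weight_eq_sum_skyline[of n \<gamma>] case_prod_unfold)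
qed

section \<open>Bounds on exponents\<close>

text \<open>For fixed n and m this is a finite set of vectors, closed under passing from a shape to
  the contents of its fillings. Weights are bounded on it, so a recursion along increasing weight
  terminates.\<close>

definition exponents_within :: "nat \<Rightarrow> nat \<Rightarrow> (nat \<Rightarrow>\<^sub>0 nat) \<Rightarrow> bool" where
  "exponents_within n m \<delta> \<longleftrightarrow> Poly_Mapping.keys \<delta> \<subseteq> {..<n} \<and> (\<forall>i. Poly_Mapping.lookup \<delta> i \<le> m)"

lemma weight_le_of_exponents_within:
  assumes "exponents_within n m \<delta>"
  shows "weight n \<delta> \<le> n * (m * n)"
proof -
  have "weight n \<delta> = (\<Sum>i<n. Poly_Mapping.lookup \<delta> i * (n - i))"
    using assms by (intro weight_eq_sum) (auto simp: exponents_within_def)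
  also have "\<dots> \<le> (\<Sum>i<n. m * n)"
    using assms by (intro sum_mono mult_mono) (auto simp: exponents_within_def)
  finally show ?thesis by simp
qed

lemma exponents_within_exists:
  assumes "finite A"
  shows "\<exists>n m. \<forall>\<delta> \<in> A. exponents_within n m \<delta>"
  using assms
proof (induction A)
  case (insert \<gamma> A)
  then obtain n m where nm: "\<forall>\<delta> \<in> A. exponents_within n m \<delta>" by blast
  \<comment> \<open>Inserting 0 keeps \<open>Max\<close> defined when \<open>\<gamma>\<close> is
    zero; below, the total size serves as a crude bound for every part.\<close>
  define n' where "n' = max n (Suc (Max (insert 0 (Poly_Mapping.keys \<gamma>))))"
  define m' where "m' = max m (comp_size \<gamma>)"
  have "i < n'" if "i \<in> Poly_Mapping.keys \<gamma>" for i
    using that by (auto simp: n'_def less_Suc_eq_le less_max_iff_disj)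
  moreover have "Poly_Mapping.lookup \<gamma> i \<le> m'" for i
    by (cases "i \<in> Poly_Mapping.keys \<gamma>")
      (auto simp: m'_def comp_size_def in_keys_iff le_max_iff_disj intro!: disjI2 member_le_sum)
  ultimately have "exponents_within n' m' \<gamma>" by (auto simp: exponents_within_def)
  moreover have "exponents_within n' m' \<delta>" if "\<delta> \<in> A" for \<delta>
    using nm that unfolding exponents_within_def n'_def m'_def
    by (meson lessThan_subset_iff max.coboundedI1 max.cobounded1 subset_trans)
  ultimately show ?case by blast
qed simp

text \<open>A value occurs at most once in each of the columns 1 to m, by distinctness in columns,
  and an entry never exceeds its row index, which is below n.\<close>

lemma exponents_within_content:
  assumes F: "F \<in> SetSkyFill \<gamma>" and \<gamma>: "exponents_within n m \<gamma>"
  shows "exponents_within n m (content \<gamma> F)"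
proof -
  have "multiplicity_in \<gamma> F x \<le> m" for x
  proof -
    let ?B = "{(i, k) \<in> skyline \<gamma>. x \<in> F i k}"
    have "inj_on snd ?B"
      using F by (fastforce simp: inj_on_def SetSkyFill_def column_distinct_def)
    moreover have "snd ` ?B \<subseteq> {1..m}"
      using \<gamma> by (force simp: skyline_def is_box_def exponents_within_def intro: order_trans)
    ultimately have "card ?B \<le> card {1..m}" by (intro card_inj_on_le) auto
    then show ?thesis by (simp add: multiplicity_in_def)
  qed
  moreover have "x < n" if "multiplicity_in \<gamma> F x \<noteq> 0" for x
  proof -
    have "{(i, k) \<in> skyline \<gamma>. x \<in> F i k} \<noteq> {}"
      using that unfolding multiplicity_in_def by (metis card.empty)
    then obtain i k where ik: "(i, k) \<in> skyline \<gamma>" "x \<in> F i k" by blast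
    then have "i < n" using \<gamma> by (auto simp: skyline_Sigma exponents_within_def)
    then show ?thesis using SetSkyFill_entry_le[OF F ik(2)] by simp
  qed
  ultimately show ?thesis
    by (auto simp: exponents_within_def in_keys_iff lookup_content[OF F])
qed

section \<open>Unitriangularity of the atoms\<close>

text \<open>The constant filling is split off; it has one entry per box, so its power of
  \<open>beta\<close> is 1.\<close>

lemma lascoux_atom_eq:
  "lascoux_atom \<gamma> = Poly_Mapping.single \<gamma> 1 + (\<Sum>F \<in> SetSkyFill \<gamma> - {constant_filling \<gamma>}.
     Poly_Mapping.single (content \<gamma> F) (beta ^ (num_entries \<gamma> F - comp_size \<gamma>)))"
  unfolding lascoux_atom_def
  by (subst sum.remove[OF finite_SetSkyFill constant_filling_in_SetSkyFill])
    (simp add: Const_def filling_monomial_eq_single mult_single content_constant_filling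
      num_entries_constant_filling)

lemma Const_mult_single: "Const a * Poly_Mapping.single \<delta> b = Poly_Mapping.single \<delta> (a * b)"
  by (simp add: Const_def mult_single)

lemma lookup_Const_mult:
  "Poly_Mapping.lookup (Const a * p) \<delta> = a * Poly_Mapping.lookup p \<delta>"
  \<comment> \<open>The coefficient formula of \<open>Poly_Mapping.map\<close> is guarded by nonzero
    coefficients, hence the case split.\<close>
  by (cases "Poly_Mapping.lookup p \<delta> = 0")
    (simp_all add: Const_def mult_map_scale_conv_mult[symmetric] map.rep_eq when_def)

lemma lookup_lascoux_atom_self:
  assumes "\<And>i. i \<in> Poly_Mapping.keys \<gamma> \<Longrightarrow> i < n"
  shows "Poly_Mapping.lookup (lascoux_atom \<gamma>) \<gamma> = 1"
proof -
  have "content \<gamma> F \<noteq> \<gamma>" if "F \<in> SetSkyFill \<gamma>" "F \<noteq> constant_filling \<gamma>" for F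
    using weight_less_weight_content[OF that assms] by auto
  then show ?thesis
    by (simp add: lascoux_atom_eq lookup_add lookup_sum lookup_single when_def sum.neutral)
qed

text \<open>All exponents of the atom apart from \<open>\<gamma>\<close> weigh strictly more than
  \<open>\<gamma>\<close>.\<close>

lemma lookup_lascoux_atom_eq_0:
  assumes "\<And>i. i \<in> Poly_Mapping.keys \<gamma> \<Longrightarrow> i < n" "weight n \<delta> \<le> weight n \<gamma>" "\<delta> \<noteq> \<gamma>"
  shows "Poly_Mapping.lookup (lascoux_atom \<gamma>) \<delta> = 0"
proof -
  have "content \<gamma> F \<noteq> \<delta>" if "F \<in> SetSkyFill \<gamma>" "F \<noteq> constant_filling \<gamma>" for F
    using weight_less_weight_content[OF that assms(1)] assms(2) by auto
  then show ?thesis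
    using assms(3) by (simp add: lascoux_atom_eq lookup_add lookup_sum lookup_single when_def sum.neutral)
qed

section \<open>Linear combinations and independence\<close>

text \<open>Viewed as an additive map, its surjectivity is existence in the theorem and its
  injectivity is uniqueness.\<close>

definition atom_combination :: "(weak_composition \<Rightarrow>\<^sub>0 int poly) \<Rightarrow> beta_mpoly" where
  "atom_combination c =
     (\<Sum>\<gamma> \<in> Poly_Mapping.keys c. Const (Poly_Mapping.lookup c \<gamma>) * lascoux_atom \<gamma>)"

lemma Const_0: "Const 0 = 0"
  by (simp add: Const_def)

lemma Const_add: "Const (a + b) = Const a + Const b"
  by (simp add: Const_def single_add)

lemma atom_combination_eq_sum:
  assumes "finite A" "Poly_Mapping.keys c \<subseteq> A"
  shows "atom_combination c = (\<Sum>\<gamma> \<in> A. Const (Poly_Mapping.lookup c \<gamma>) * lascoux_atom \<gamma>)"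
  unfolding atom_combination_def
  by (rule sum.mono_neutral_left) (use assms in \<open>auto simp: in_keys_iff Const_0\<close>)

lemma atom_combination_single: "atom_combination (Poly_Mapping.single \<gamma> a) = Const a * lascoux_atom \<gamma>"
  by (subst atom_combination_eq_sum[of "{\<gamma>}"]) auto

lemma atom_combination_add: "atom_combination (c + d) = atom_combination c + atom_combination d"
proof -
  \<comment> \<open>A common index set, since cancellation can make the keys of \<open>c + d\<close>
    smaller than this union.\<close>
  let ?A = "Poly_Mapping.keys c \<union> Poly_Mapping.keys d"
  have "atom_combination e = (\<Sum>\<gamma> \<in> ?A. Const (Poly_Mapping.lookup e \<gamma>) * lascoux_atom \<gamma>)"
    if "e \<in> {c, d, c + d}" for e
    using that keys_add[of c d] by (intro atom_combination_eq_sum) auto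
  then show ?thesis
    by (simp add: lookup_add Const_add distrib_right sum.distrib)
qed

text \<open>At a key \<open>\<gamma>\<close> of c of least weight, no other atom of the combination
  has a \<open>\<gamma>\<close>-term, so the coefficient there is that of c and cannot
  vanish.\<close>

lemma atom_combination_eq_0_imp:
  assumes "atom_combination c = 0"
  shows "c = 0"
proof (rule ccontr)
  assume "c \<noteq> 0"
  then have ne: "Poly_Mapping.keys c \<noteq> {}" by simp
  obtain n m where nm: "\<forall>\<gamma> \<in> Poly_Mapping.keys c. exponents_within n m \<gamma>"
    using exponents_within_exists finite_keys by blast
  then have lt: "i < n" if "\<gamma> \<in> Poly_Mapping.keys c" "i \<in> Poly_Mapping.keys \<gamma>" for \<gamma> i
    using that by (auto simp: exponents_within_def)
  obtain \<gamma> where \<gamma>: "\<gamma> \<in> Poly_Mapping.keys c"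
    "\<And>\<delta>. \<delta> \<in> Poly_Mapping.keys c \<Longrightarrow> weight n \<gamma> \<le> weight n \<delta>"
    using ne arg_min_if_finite[OF finite_keys ne, of "weight n"] by (metis not_less)
  have "Poly_Mapping.lookup (Const (Poly_Mapping.lookup c \<delta>) * lascoux_atom \<delta>) \<gamma> =
      (if \<delta> = \<gamma> then Poly_Mapping.lookup c \<gamma> else 0)" if "\<delta> \<in> Poly_Mapping.keys c" for \<delta>
    using that lt \<gamma>(2)[OF that] lookup_lascoux_atom_self[of \<delta> n] lookup_lascoux_atom_eq_0[of \<delta> n \<gamma>]
    by (auto simp: lookup_Const_mult)
  then have "Poly_Mapping.lookup (atom_combination c) \<gamma> =
      (\<Sum>\<delta> \<in> Poly_Mapping.keys c. if \<delta> = \<gamma> then Poly_Mapping.lookup c \<gamma> else 0)"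
    by (simp add: atom_combination_def lookup_sum)
  also have "\<dots> = Poly_Mapping.lookup c \<gamma>" using \<gamma>(1) by simp
  finally show False using assms \<gamma>(1) by (simp add: in_keys_iff)
qed

section \<open>Spanning\<close>

lemma range_atom_combination_sum:
  assumes "\<And>a. a \<in> A \<Longrightarrow> f a \<in> range atom_combination"
  shows "(\<Sum>a \<in> A. f a) \<in> range atom_combination"
  using assms
proof (induction A rule: infinite_finite_induct)
  case (insert a A)
  then obtain c d where "f a = atom_combination c" "(\<Sum>a \<in> A. f a) = atom_combination d" by blast
  then have "(\<Sum>a \<in> insert a A. f a) = atom_combination (c + d)"
    using insert by (simp add: atom_combination_add)
  then show ?case by blast
qed (auto simp: atom_combination_def intro!: image_eqI[of _ _ 0])

text \<open>Subtracting a times the atom of \<open>\<gamma>\<close> cancels the leading term and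
  leaves terms of larger weight within the same bounds, so the gap to the maximal weight
  \<open>n * (m * n)\<close> shrinks. The coefficient is generalized because the new terms carry
  powers of \<open>beta\<close>.\<close>

lemma single_in_range_atom_combination:
  assumes "exponents_within n m \<gamma>"
  shows "Poly_Mapping.single \<gamma> a \<in> range atom_combination"
  using assms
proof (induction "n * (m * n) - weight n \<gamma>" arbitrary: \<gamma> a rule: less_induct)
  case less
  \<comment> \<open>The correction added to a times the atom to leave only the leading term; the
    sign sits in the coefficients so that the induction hypothesis covers each term.\<close>
  define R where "R = (\<Sum>F \<in> SetSkyFill \<gamma> - {constant_filling \<gamma>}.
     Poly_Mapping.single (content \<gamma> F) (- a * beta ^ (num_entries \<gamma> F - comp_size \<gamma>)))"
  have "R \<in> range atom_combination"
    unfolding R_def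
  proof (rule range_atom_combination_sum)
    fix F assume F: "F \<in> SetSkyFill \<gamma> - {constant_filling \<gamma>}"
    have within: "exponents_within n m (content \<gamma> F)"
      using F less.prems by (auto intro: exponents_within_content)
    have "weight n \<gamma> < weight n (content \<gamma> F)"
      using F less.prems by (intro weight_less_weight_content) (auto simp: exponents_within_def)
    with weight_le_of_exponents_within[OF within]
    show "Poly_Mapping.single (content \<gamma> F) (- a * beta ^ (num_entries \<gamma> F - comp_size \<gamma>))
        \<in> range atom_combination"
      by (intro less.hyps within) simp
  qed
  then obtain c where c: "R = atom_combination c" by blast
  have "Const a * lascoux_atom \<gamma> + R = Poly_Mapping.single \<gamma> a"
    by (simp add: R_def lascoux_atom_eq distrib_left sum_distrib_left Const_mult_single
        single_uminus sum_negf)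
  then have "Poly_Mapping.single \<gamma> a = atom_combination (Poly_Mapping.single \<gamma> a + c)"
    by (simp add: atom_combination_add atom_combination_single c)
  then show ?case by blast
qed

theorem proposition2p2:
  fixes p :: beta_mpoly
  shows "\<exists>!c :: weak_composition \<Rightarrow>\<^sub>0 int poly.
    p = (\<Sum>\<gamma> \<in> Poly_Mapping.keys c. Const (Poly_Mapping.lookup c \<gamma>) * lascoux_atom \<gamma>)"
  unfolding atom_combination_def[symmetric]
proof (rule ex_ex1I)
  obtain n m where nm: "\<forall>\<gamma> \<in> Poly_Mapping.keys p. exponents_within n m \<gamma>"
    using exponents_within_exists finite_keys by blast
  have "p = (\<Sum>\<gamma> \<in> Poly_Mapping.keys p. Poly_Mapping.single \<gamma> (Poly_Mapping.lookup p \<gamma>))"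
    by (rule poly_mapping_eqI) (simp add: lookup_sum lookup_single when_def in_keys_iff)
  moreover have "\<dots> \<in> range atom_combination"
    using nm by (intro range_atom_combination_sum single_in_range_atom_combination) blast
  ultimately show "\<exists>c. p = atom_combination c" by auto
next
  fix c d assume "p = atom_combination c" "p = atom_combination d"
  \<comment> \<open>Additivity reduces uniqueness to the trivial kernel.\<close>
  moreover have "atom_combination c = atom_combination (c - d) + atom_combination d"
    by (simp add: atom_combination_add[symmetric])
  ultimately have "atom_combination (c - d) = 0" by simp
  then show "c = d" using atom_combination_eq_0_imp by fastforce
qed

end
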